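(* Let $k$ be a commutative ring, let $\mathcal{A}$ be a Krull-Schmidt $k$-category and let $\mathcal{I}$ be an admissible ideal of $\mathcal{A}$. Suppose $X=\bigoplus_{i=1}^{n}X_{i}$ and $Y=\bigoplus_{j=1}^{m}Y_{j}$ are decompositions into indecomposables in $\mathcal{A}$ with $1_{X_i}\notin\mathcal{I}(X_i,X_i)$ and $1_{Y_j}\notin\mathcal{I}(Y_j,Y_j)$ for all $i,j$. Then a morphism $f\colon X\to Y$ is irreducible in $\mathcal{A}$ if and only if $\overline{f}=f+\mathcal{I}(X,Y)$ is irreducible in the additive quotient category $\mathcal{A}/\mathcal{I}$.
   Context: A $k$-category is an additive category whose Hom-sets are $k$-modules and whose composition is $k$-bilinear. An additive category is Krull-Schmidt if every object is a finite direct sum of objects with local endomorphism rings. Ideals are two-sided ideals of morphisms; $\mathcal{A}/\mathcal{I}$ has the same objects as $\mathcal{A}$ and Hom-modules $\operatorname{Hom}_{\mathcal{A}}(X,Y)/\mathcal{I}(X,Y)$. The radical is $\operatorname{rad}_{\mathcal{A}}(X,Y)=\{f\in\operatorname{Hom}_{\mathcal{A}}(X,Y)\mid 1_X-gf\text{ is invertible for all }g\colon Y\to X\}$, and $\operatorname{rad}^2_{\mathcal{A}}(X,Y)$ is the $k$-submodule of $\operatorname{Hom}_{\mathcal{A}}(X,Y)$ generated by morphisms that are compositions of two radical morphisms. A morphism $f\colon X\to Y$ is right almost split if it is not a retraction and every non-retraction $u\colon U\to Y$ factors as $u=f\hat u$; it is right minimal if $fg=f$ with $g\colon X\to X$ implies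 $g$ is an automorphism; it is minimal right almost split if both hold. Minimal left almost split is defined dually. An ideal $\mathcal{I}$ of a Krull-Schmidt $k$-category $\mathcal{A}$ is admissible if: (1) whenever $X,Y$ are indecomposable with $1_X\notin\mathcal{I}(X,X)$ and $1_Y\notin\mathcal{I}(Y,Y)$, then $\mathcal{I}(X,Y)\subseteq\operatorname{rad}^2_{\mathcal{A}}(X,Y)$; (2) if $f\colon X\to Y$ is minimal left almost split with $1_X\notin\mathcal{I}(X,X)$ and $g\in\mathcal{I}(X,M)$, then $g=hf$ for some $h\in\mathcal{I}(Y,M)$; (3) if $f\colon X\to Y$ is minimal right almost split with $1_Y\notin\mathcal{I}(Y,Y)$ and $g\in\mathcal{I}(M,Y)$, then $g=fh$ for some $h\in\mathcal{I}(M,X)$. A morphism $f\colon X\to Y$ is irreducible if it is neither a section nor a retraction, and whenever $f=hg$, either $h$ is a retraction or $g$ is a section. *)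

theory Defs
  imports "HOL-Algebra.Module" "HOL-Algebra.Ideal" "HOL.Hull"
begin

text \<open>
  Hom-sets are HOL-Algebra modules, of which only the fields \<open>carrier\<close>, \<open>add\<close>, \<open>zero\<close> and
  \<open>smult\<close> are meaningful (the record also carries an unused multiplication and unit).
  Composition is indexed by the three objects involved, so that different Hom-sets need not be
  disjoint: \<open>Comp A X Y Z g f\<close> is the composite \<open>gf\<close> of \<open>f : X \<rightarrow> Y\<close> and \<open>g : Y \<rightarrow> Z\<close>.
\<close>

record ('k, 'o, 'm) k_cat =
  Ob   :: "'o set"
  Hom  :: "'o \<Rightarrow> 'o \<Rightarrow> ('k, 'm) module"
  Comp :: "'o \<Rightarrow> 'o \<Rightarrow> 'o \<Rightarrow> 'm \<Rightarrow> 'm \<Rightarrow> 'm"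
  Idm  :: "'o \<Rightarrow> 'm"

abbreviation Mor :: "('k, 'o, 'm) k_cat \<Rightarrow> 'o \<Rightarrow> 'o \<Rightarrow> 'm set"
  where "Mor A X Y \<equiv> carrier (Hom A X Y)"


section \<open>Additive k-categories\<close>

locale k_linear_category = cring k for k (structure) +
  fixes A :: "('k, 'o, 'm) k_cat"
  assumes Hom_module:
      "\<lbrakk>X \<in> Ob A; Y \<in> Ob A\<rbrakk> \<Longrightarrow> module k (Hom A X Y)"
    and Comp_closed:
      "\<lbrakk>X \<in> Ob A; Y \<in> Ob A; Z \<in> Ob A; f \<in> Mor A X Y; g \<in> Mor A Y Z\<rbrakk>
        \<Longrightarrow> Comp A X Y Z g f \<in> Mor A X Z"
    and Idm_closed:
      "X \<in> Ob A \<Longrightarrow> Idm A X \<in> Mor A X X"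
    and Comp_assoc:
      "\<lbrakk>W \<in> Ob A; X \<in> Ob A; Y \<in> Ob A; Z \<in> Ob A; f \<in> Mor A W X; g \<in> Mor A X Y; h \<in> Mor A Y Z\<rbrakk>
        \<Longrightarrow> Comp A W X Z (Comp A X Y Z h g) f = Comp A W Y Z h (Comp A W X Y g f)"
    and Comp_Idm_left:
      "\<lbrakk>X \<in> Ob A; Y \<in> Ob A; f \<in> Mor A X Y\<rbrakk> \<Longrightarrow> Comp A X Y Y (Idm A Y) f = f"
    and Comp_Idm_right:
      "\<lbrakk>X \<in> Ob A; Y \<in> Ob A; f \<in> Mor A X Y\<rbrakk> \<Longrightarrow> Comp A X X Y f (Idm A X) = f"
    and Comp_add_left:
      "\<lbrakk>X \<in> Ob A; Y \<in> Ob A; Z \<in> Ob A; f \<in> Mor A X Y; g \<in> Mor A Y Z; g' \<in> Mor A Y Z\<rbrakk>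
        \<Longrightarrow> Comp A X Y Z (g \<oplus>\<^bsub>Hom A Y Z\<^esub> g') f
            = Comp A X Y Z g f \<oplus>\<^bsub>Hom A X Z\<^esub> Comp A X Y Z g' f"
    and Comp_add_right:
      "\<lbrakk>X \<in> Ob A; Y \<in> Ob A; Z \<in> Ob A; f \<in> Mor A X Y; f' \<in> Mor A X Y; g \<in> Mor A Y Z\<rbrakk>
        \<Longrightarrow> Comp A X Y Z g (f \<oplus>\<^bsub>Hom A X Y\<^esub> f')
            = Comp A X Y Z g f \<oplus>\<^bsub>Hom A X Z\<^esub> Comp A X Y Z g f'"
    and Comp_smult_left:
      "\<lbrakk>X \<in> Ob A; Y \<in> Ob A; Z \<in> Ob A; f \<in> Mor A X Y; g \<in> Mor A Y Z; r \<in> carrier k\<rbrakk>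
        \<Longrightarrow> Comp A X Y Z (r \<odot>\<^bsub>Hom A Y Z\<^esub> g) f = r \<odot>\<^bsub>Hom A X Z\<^esub> Comp A X Y Z g f"
    and Comp_smult_right:
      "\<lbrakk>X \<in> Ob A; Y \<in> Ob A; Z \<in> Ob A; f \<in> Mor A X Y; g \<in> Mor A Y Z; r \<in> carrier k\<rbrakk>
        \<Longrightarrow> Comp A X Y Z g (r \<odot>\<^bsub>Hom A X Y\<^esub> f) = r \<odot>\<^bsub>Hom A X Z\<^esub> Comp A X Y Z g f"

definition zero_object :: "('k, 'o, 'm) k_cat \<Rightarrow> 'o \<Rightarrow> bool" where
  "zero_object A Z \<longleftrightarrow> Z \<in> Ob A \<and>
     (\<forall>X\<in>Ob A. (\<exists>!f. f \<in> Mor A X Z) \<and> (\<exists>!f. f \<in> Mor A Z X))"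

text \<open>
  \<open>direct_sum A X [X\<^sub>1, \<dots>, X\<^sub>n]\<close>: the object \<open>X\<close> is a direct sum (biproduct) of \<open>X\<^sub>1, \<dots>, X\<^sub>n\<close>,
  for some choice of injections \<open>\<iota>\<close> and projections \<open>\<pi>\<close>. For the empty list the last equation
  says that the identity of \<open>X\<close> vanishes.
\<close>

definition direct_sum :: "('k, 'o, 'm) k_cat \<Rightarrow> 'o \<Rightarrow> 'o list \<Rightarrow> bool" where
  "direct_sum A X Xs \<longleftrightarrow> X \<in> Ob A \<and> set Xs \<subseteq> Ob A \<and>
     (\<exists>\<iota> \<pi>. (\<forall>i<length Xs. \<iota> i \<in> Mor A (Xs ! i) X \<and> \<pi> i \<in> Mor A X (Xs ! i)) \<and>
        (\<forall>i<length Xs. \<forall>j<length Xs. Comp A (Xs ! j) X (Xs ! i) (\<pi> i) (\<iota> j) =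
            (if i = j then Idm A (Xs ! i) else \<zero>\<^bsub>Hom A (Xs ! j) (Xs ! i)\<^esub>)) \<and>
        (\<Oplus>\<^bsub>Hom A X X\<^esub>i\<in>{..<length Xs}. Comp A X (Xs ! i) X (\<iota> i) (\<pi> i)) = Idm A X)"

locale k_category = k_linear_category +
  assumes ex_zero_object: "\<exists>Z. zero_object A Z"
    and ex_direct_sum: "\<lbrakk>X \<in> Ob A; Y \<in> Ob A\<rbrakk> \<Longrightarrow> \<exists>S. direct_sum A S [X, Y]"

definition indecomposable :: "('k, 'o, 'm) k_cat \<Rightarrow> 'o \<Rightarrow> bool" where
  "indecomposable A X \<longleftrightarrow> X \<in> Ob A \<and> \<not> zero_object A X \<and>
     (\<forall>U V. direct_sum A X [U, V] \<longrightarrow> zero_object A U \<or> zero_object A V)"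

definition End_ring :: "('k, 'o, 'm) k_cat \<Rightarrow> 'o \<Rightarrow> 'm ring" where
  "End_ring A X = \<lparr>carrier = Mor A X X, mult = Comp A X X X, one = Idm A X,
                   zero = \<zero>\<^bsub>Hom A X X\<^esub>, add = add (Hom A X X)\<rparr>"

text \<open>
  A (not necessarily commutative) ring is local if its non-units form an ideal. That ideal is
  proper since \<open>\<one>\<close> is a unit, so the zero ring is not local.
\<close>

definition local_ring :: "('a, 'b) ring_scheme \<Rightarrow> bool" where
  "local_ring R \<longleftrightarrow> ideal (carrier R - Units R) R"

locale krull_schmidt = k_category +
  assumes ex_local_decomposition:
    "X \<in> Ob A \<Longrightarrow> \<exists>Xs. direct_sum A X Xs \<and> (\<forall>U\<in>set Xs. local_ring (End_ring A U))"


section \<open>Classes of morphisms\<close>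

definition section_mor :: "('k, 'o, 'm) k_cat \<Rightarrow> 'o \<Rightarrow> 'o \<Rightarrow> 'm \<Rightarrow> bool" where
  "section_mor A X Y f \<longleftrightarrow> f \<in> Mor A X Y \<and> (\<exists>g\<in>Mor A Y X. Comp A X Y X g f = Idm A X)"

definition retraction_mor :: "('k, 'o, 'm) k_cat \<Rightarrow> 'o \<Rightarrow> 'o \<Rightarrow> 'm \<Rightarrow> bool" where
  "retraction_mor A X Y f \<longleftrightarrow> f \<in> Mor A X Y \<and> (\<exists>g\<in>Mor A Y X. Comp A Y X Y f g = Idm A Y)"

definition invertible_mor :: "('k, 'o, 'm) k_cat \<Rightarrow> 'o \<Rightarrow> 'o \<Rightarrow> 'm \<Rightarrow> bool" where
  "invertible_mor A X Y f \<longleftrightarrow> f \<in> Mor A X Y \<and>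
     (\<exists>g\<in>Mor A Y X. Comp A X Y X g f = Idm A X \<and> Comp A Y X Y f g = Idm A Y)"

definition irreducible_mor :: "('k, 'o, 'm) k_cat \<Rightarrow> 'o \<Rightarrow> 'o \<Rightarrow> 'm \<Rightarrow> bool" where
  "irreducible_mor A X Y f \<longleftrightarrow> f \<in> Mor A X Y \<and>
     \<not> section_mor A X Y f \<and> \<not> retraction_mor A X Y f \<and>
     (\<forall>Z\<in>Ob A. \<forall>g\<in>Mor A X Z. \<forall>h\<in>Mor A Z Y.
        f = Comp A X Z Y h g \<longrightarrow> retraction_mor A Z Y h \<or> section_mor A X Z g)"

definition right_almost_split :: "('k, 'o, 'm) k_cat \<Rightarrow> 'o \<Rightarrow> 'o \<Rightarrow> 'm \<Rightarrow> bool" where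
  "right_almost_split A X Y f \<longleftrightarrow> f \<in> Mor A X Y \<and> \<not> retraction_mor A X Y f \<and>
     (\<forall>U\<in>Ob A. \<forall>u\<in>Mor A U Y. \<not> retraction_mor A U Y u \<longrightarrow>
        (\<exists>u'\<in>Mor A U X. u = Comp A U X Y f u'))"

definition right_minimal :: "('k, 'o, 'm) k_cat \<Rightarrow> 'o \<Rightarrow> 'o \<Rightarrow> 'm \<Rightarrow> bool" where
  "right_minimal A X Y f \<longleftrightarrow> f \<in> Mor A X Y \<and>
     (\<forall>g\<in>Mor A X X. Comp A X X Y f g = f \<longrightarrow> invertible_mor A X X g)"

definition left_almost_split :: "('k, 'o, 'm) k_cat \<Rightarrow> 'o \<Rightarrow> 'o \<Rightarrow> 'm \<Rightarrow> bool" where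
  "left_almost_split A X Y f \<longleftrightarrow> f \<in> Mor A X Y \<and> \<not> section_mor A X Y f \<and>
     (\<forall>U\<in>Ob A. \<forall>u\<in>Mor A X U. \<not> section_mor A X U u \<longrightarrow>
        (\<exists>u'\<in>Mor A Y U. u = Comp A X Y U u' f))"

definition left_minimal :: "('k, 'o, 'm) k_cat \<Rightarrow> 'o \<Rightarrow> 'o \<Rightarrow> 'm \<Rightarrow> bool" where
  "left_minimal A X Y f \<longleftrightarrow> f \<in> Mor A X Y \<and>
     (\<forall>g\<in>Mor A Y Y. Comp A X Y Y g f = f \<longrightarrow> invertible_mor A Y Y g)"

definition minimal_right_almost_split :: "('k, 'o, 'm) k_cat \<Rightarrow> 'o \<Rightarrow> 'o \<Rightarrow> 'm \<Rightarrow> bool" where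
  "minimal_right_almost_split A X Y f \<longleftrightarrow> right_minimal A X Y f \<and> right_almost_split A X Y f"

definition minimal_left_almost_split :: "('k, 'o, 'm) k_cat \<Rightarrow> 'o \<Rightarrow> 'o \<Rightarrow> 'm \<Rightarrow> bool" where
  "minimal_left_almost_split A X Y f \<longleftrightarrow> left_minimal A X Y f \<and> left_almost_split A X Y f"


section \<open>Radical, ideals and quotients\<close>

definition rad :: "('k, 'o, 'm) k_cat \<Rightarrow> 'o \<Rightarrow> 'o \<Rightarrow> 'm set" where
  "rad A X Y = {f \<in> Mor A X Y. \<forall>g\<in>Mor A Y X.
     invertible_mor A X X (Idm A X \<ominus>\<^bsub>Hom A X X\<^esub> Comp A X Y X g f)}"

definition rad_square ::
    "('k, 'r) ring_scheme \<Rightarrow> ('k, 'o, 'm) k_cat \<Rightarrow> 'o \<Rightarrow> 'o \<Rightarrow> 'm set" where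
  "rad_square k A X Y = (\<lambda>N. submodule N k (Hom A X Y)) hull
     {Comp A X Z Y h g | Z g h. Z \<in> Ob A \<and> g \<in> rad A X Z \<and> h \<in> rad A Z Y}"

definition ideal_of ::
    "('k, 'r) ring_scheme \<Rightarrow> ('k, 'o, 'm) k_cat \<Rightarrow> ('o \<Rightarrow> 'o \<Rightarrow> 'm set) \<Rightarrow> bool" where
  "ideal_of k A I \<longleftrightarrow>
     (\<forall>X\<in>Ob A. \<forall>Y\<in>Ob A. submodule (I X Y) k (Hom A X Y)) \<and>
     (\<forall>X\<in>Ob A. \<forall>Y\<in>Ob A. \<forall>Z\<in>Ob A. \<forall>f\<in>I X Y. \<forall>g\<in>Mor A Y Z. Comp A X Y Z g f \<in> I X Z) \<and>
     (\<forall>X\<in>Ob A. \<forall>Y\<in>Ob A. \<forall>Z\<in>Ob A. \<forall>f\<in>Mor A X Y. \<forall>g\<in>I Y Z. Comp A X Y Z g f \<in> I X Z)"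

definition admissible_ideal ::
    "('k, 'r) ring_scheme \<Rightarrow> ('k, 'o, 'm) k_cat \<Rightarrow> ('o \<Rightarrow> 'o \<Rightarrow> 'm set) \<Rightarrow> bool" where
  "admissible_ideal k A I \<longleftrightarrow> ideal_of k A I \<and>
     (\<forall>X Y. indecomposable A X \<and> indecomposable A Y \<and> Idm A X \<notin> I X X \<and> Idm A Y \<notin> I Y Y \<longrightarrow>
        I X Y \<subseteq> rad_square k A X Y) \<and>
     (\<forall>X\<in>Ob A. \<forall>Y\<in>Ob A. \<forall>M\<in>Ob A. \<forall>f g.
        minimal_left_almost_split A X Y f \<and> Idm A X \<notin> I X X \<and> g \<in> I X M \<longrightarrow>
        (\<exists>h\<in>I Y M. g = Comp A X Y M h f)) \<and>
     (\<forall>X\<in>Ob A. \<forall>Y\<in>Ob A. \<forall>M\<in>Ob A. \<forall>f g.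
        minimal_right_almost_split A X Y f \<and> Idm A Y \<notin> I Y Y \<and> g \<in> I M Y \<longrightarrow>
        (\<exists>h\<in>I M X. g = Comp A M X Y f h))"

text \<open>
  Operations on cosets are written as unions over representatives, in the style of the ring
  structure on \<open>R Quot I\<close>; for a submodule (respectively an ideal) all the sets in the union
  coincide.
\<close>

definition quotient_module :: "('k, 'm) module \<Rightarrow> 'm set \<Rightarrow> ('k, 'm set) module" where
  "quotient_module M N =
     \<lparr>carrier = a_rcosets\<^bsub>M\<^esub> N, mult = undefined, one = undefined,
      zero = N, add = set_add M, smult = (\<lambda>r C. \<Union>c\<in>C. N +>\<^bsub>M\<^esub> (r \<odot>\<^bsub>M\<^esub> c))\<rparr>"

definition quotient_category ::
    "('k, 'o, 'm) k_cat \<Rightarrow> ('o \<Rightarrow> 'o \<Rightarrow> 'm set) \<Rightarrow> ('k, 'o, 'm set) k_cat" where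
  "quotient_category A I =
     \<lparr>Ob = Ob A,
      Hom = (\<lambda>X Y. quotient_module (Hom A X Y) (I X Y)),
      Comp = (\<lambda>X Y Z G F. \<Union>g\<in>G. \<Union>f\<in>F. I X Z +>\<^bsub>Hom A X Z\<^esub> Comp A X Y Z g f),
      Idm = (\<lambda>X. I X X +>\<^bsub>Hom A X X\<^esub> Idm A X)\<rparr>"

end

theory Submission
  imports Defs
begin

text \<open>
  Everything rests on two observations about a morphism \<open>c\<close> in the ideal.

  Between \<open>X\<close> and \<open>Y\<close> as in the theorem, \<open>c\<close> lies in \<open>rad\<^sup>2\<close>: its components between
  indecomposable summands do, by admissibility, and \<open>rad\<^sup>2\<close> is stable under composition and sums
  (\<open>ideal_subset_rad_square\<close>).  Moreover, since biproducts exist, an element of \<open>rad\<^sup>2\<close> is a single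
  composite \<open>ba\<close> of two radical morphisms \<open>a : X \<rightarrow> W\<close> and \<open>b : W \<rightarrow> Y\<close>, not merely a linear
  combination of such composites (\<open>rad_square_eq_composites\<close>).

  Secondly, radical perturbations of an identity are invertible.  So \<open>hs + c = 1\<close> with \<open>c\<close> radical
  makes \<open>h\<close> a retraction and \<open>s\<close> a section.  By the first observation for the pairs \<open>X, X\<close> and
  \<open>Y, Y\<close>, the quotient functor therefore reflects sections out of \<open>X\<close> and retractions onto \<open>Y\<close>, and
  this already shows that \<open>f\<close> is irreducible if its class is.

  Conversely let \<open>f\<close> be irreducible and let its class factor, that is, \<open>f = hg + c\<close> with \<open>c\<close> in the
  ideal, where \<open>g : X \<rightarrow> Z\<close> and \<open>h : Z \<rightarrow> Y\<close>.  Write \<open>c = ba\<close> as above.  Then \<open>f\<close> is the composite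
  of the column \<open>(g, a)\<close> and the row \<open>(h, b)\<close> through \<open>Z \<oplus> W\<close>, so the row is a retraction or the
  column is a section.  In the first case \<open>hs + bt = 1\<close> for some \<open>s\<close> and \<open>t\<close>, where \<open>bt\<close> is radical
  because \<open>b\<close> is, so \<open>h\<close> is a retraction; the second case is dual
  (\<open>irreducible_factor_modulo_rad_square\<close>).
\<close>


section \<open>Linearity of composition\<close>

context k_linear_category
begin

lemma Hom_abelian_group:
  "\<lbrakk>X \<in> Ob A; Y \<in> Ob A\<rbrakk> \<Longrightarrow> abelian_group (Hom A X Y)"
  using Hom_module module.axioms(2) by blast

lemma Comp_zero_left:
  assumes "X \<in> Ob A" "Y \<in> Ob A" "Z \<in> Ob A" "f \<in> Mor A X Y"
  shows "Comp A X Y Z \<zero>\<^bsub>Hom A Y Z\<^esub> f = \<zero>\<^bsub>Hom A X Z\<^esub>"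
proof -
  interpret YZ: abelian_group "Hom A Y Z" using assms by (simp add: Hom_abelian_group)
  interpret XZ: abelian_group "Hom A X Z" using assms by (simp add: Hom_abelian_group)
  let ?z = "Comp A X Y Z \<zero>\<^bsub>Hom A Y Z\<^esub> f"
  have "?z \<in> Mor A X Z" using assms by (simp add: Comp_closed)
  moreover have "?z \<oplus>\<^bsub>Hom A X Z\<^esub> ?z = ?z"
    using Comp_add_left[OF assms, of "\<zero>\<^bsub>Hom A Y Z\<^esub>" "\<zero>\<^bsub>Hom A Y Z\<^esub>"] by simp
  ultimately show ?thesis using XZ.add.r_cancel_one by blast
qed

lemma Comp_zero_right:
  assumes "X \<in> Ob A" "Y \<in> Ob A" "Z \<in> Ob A" "g \<in> Mor A Y Z"
  shows "Comp A X Y Z g \<zero>\<^bsub>Hom A X Y\<^esub> = \<zero>\<^bsub>Hom A X Z\<^esub>"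
proof -
  interpret XY: abelian_group "Hom A X Y" using assms by (simp add: Hom_abelian_group)
  interpret XZ: abelian_group "Hom A X Z" using assms by (simp add: Hom_abelian_group)
  let ?z = "Comp A X Y Z g \<zero>\<^bsub>Hom A X Y\<^esub>"
  have "?z \<in> Mor A X Z" using assms by (simp add: Comp_closed)
  moreover have "?z \<oplus>\<^bsub>Hom A X Z\<^esub> ?z = ?z"
    using Comp_add_right[OF assms(1-3) _ _ assms(4), of "\<zero>\<^bsub>Hom A X Y\<^esub>" "\<zero>\<^bsub>Hom A X Y\<^esub>"] by simp
  ultimately show ?thesis using XZ.add.r_cancel_one by blast
qed

lemma Comp_minus_left:
  assumes "X \<in> Ob A" "Y \<in> Ob A" "Z \<in> Ob A" "f \<in> Mor A X Y" "g \<in> Mor A Y Z"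
  shows "Comp A X Y Z (\<ominus>\<^bsub>Hom A Y Z\<^esub> g) f = \<ominus>\<^bsub>Hom A X Z\<^esub> Comp A X Y Z g f"
proof -
  interpret YZ: abelian_group "Hom A Y Z" using assms by (simp add: Hom_abelian_group)
  interpret XZ: abelian_group "Hom A X Z" using assms by (simp add: Hom_abelian_group)
  have "Comp A X Y Z (\<ominus>\<^bsub>Hom A Y Z\<^esub> g) f \<oplus>\<^bsub>Hom A X Z\<^esub> Comp A X Y Z g f = \<zero>\<^bsub>Hom A X Z\<^esub>"
    using Comp_add_left[OF assms(1-4), of "\<ominus>\<^bsub>Hom A Y Z\<^esub> g" g] assms
    by (simp add: Comp_zero_left YZ.l_neg)
  then show ?thesis
    using XZ.minus_equality assms Comp_closed YZ.a_inv_closed by metis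
qed

lemma Comp_minus_right:
  assumes "X \<in> Ob A" "Y \<in> Ob A" "Z \<in> Ob A" "f \<in> Mor A X Y" "g \<in> Mor A Y Z"
  shows "Comp A X Y Z g (\<ominus>\<^bsub>Hom A X Y\<^esub> f) = \<ominus>\<^bsub>Hom A X Z\<^esub> Comp A X Y Z g f"
proof -
  interpret XY: abelian_group "Hom A X Y" using assms by (simp add: Hom_abelian_group)
  interpret XZ: abelian_group "Hom A X Z" using assms by (simp add: Hom_abelian_group)
  have "Comp A X Y Z g (\<ominus>\<^bsub>Hom A X Y\<^esub> f) \<oplus>\<^bsub>Hom A X Z\<^esub> Comp A X Y Z g f = \<zero>\<^bsub>Hom A X Z\<^esub>"
    using Comp_add_right[OF assms(1-3) _ assms(4,5), of "\<ominus>\<^bsub>Hom A X Y\<^esub> f"] assms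
    by (simp add: Comp_zero_right XY.l_neg)
  then show ?thesis
    using XZ.minus_equality assms Comp_closed XY.a_inv_closed by metis
qed


section \<open>Invertible morphisms and the radical\<close>

lemma invertible_Comp:
  assumes ob: "X \<in> Ob A" "Y \<in> Ob A" "Z \<in> Ob A"
    and f: "invertible_mor A X Y f" and g: "invertible_mor A Y Z g"
  shows "invertible_mor A X Z (Comp A X Y Z g f)"
proof -
  have fM: "f \<in> Mor A X Y" and gM: "g \<in> Mor A Y Z"
    using f g by (auto simp: invertible_mor_def)
  obtain f' where f': "f' \<in> Mor A Y X" "Comp A X Y X f' f = Idm A X" "Comp A Y X Y f f' = Idm A Y"
    using f by (auto simp: invertible_mor_def)
  obtain g' where g': "g' \<in> Mor A Z Y" "Comp A Y Z Y g' g = Idm A Y" "Comp A Z Y Z g g' = Idm A Z"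
    using g by (auto simp: invertible_mor_def)
  note [simp] = ob fM gM f' g' Comp_closed
  have "Comp A X Z X (Comp A Z Y X f' g') (Comp A X Y Z g f)
      = Comp A X Y X f' (Comp A X Y Y (Comp A Y Z Y g' g) f)"
    by (simp add: Comp_assoc del: g'(2,3))
  then have "Comp A X Z X (Comp A Z Y X f' g') (Comp A X Y Z g f) = Idm A X"
    by (simp add: Comp_Idm_left)
  moreover have "Comp A Z X Z (Comp A X Y Z g f) (Comp A Z Y X f' g')
      = Comp A Z Y Z g (Comp A Z Y Y (Comp A Y X Y f f') g')"
    by (simp add: Comp_assoc del: f'(2,3))
  then have "Comp A Z X Z (Comp A X Y Z g f) (Comp A Z Y X f' g') = Idm A Z"
    by (simp add: Comp_Idm_left)
  ultimately show ?thesis unfolding invertible_mor_def by (meson Comp_closed ob fM gM f'(1) g'(1))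
qed

text \<open>
  If \<open>v\<close> inverts \<open>1 - gf\<close>, then \<open>1 + fvg\<close> inverts \<open>1 - fg\<close>, as the geometric series suggests.
\<close>

lemma invertible_Idm_minus_swap:
  assumes ob: "X \<in> Ob A" "Y \<in> Ob A"
    and f: "f \<in> Mor A X Y" and g: "g \<in> Mor A Y X"
    and inv: "invertible_mor A X X (Idm A X \<ominus>\<^bsub>Hom A X X\<^esub> Comp A X Y X g f)"
  shows "invertible_mor A Y Y (Idm A Y \<ominus>\<^bsub>Hom A Y Y\<^esub> Comp A Y X Y f g)"
proof -
  interpret XX: abelian_group "Hom A X X" using ob by (simp add: Hom_abelian_group)
  interpret YX: abelian_group "Hom A Y X" using ob by (simp add: Hom_abelian_group)
  interpret XY: abelian_group "Hom A X Y" using ob by (simp add: Hom_abelian_group)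
  interpret YY: abelian_group "Hom A Y Y" using ob by (simp add: Hom_abelian_group)
  let ?r = "Comp A X Y X g f"
  let ?q = "Comp A Y X Y f g"
  note [simp] = ob f g Comp_closed Idm_closed
  obtain v where v: "v \<in> Mor A X X"
    and vl: "Comp A X X X v (Idm A X \<ominus>\<^bsub>Hom A X X\<^esub> ?r) = Idm A X"
    and vr: "Comp A X X X (Idm A X \<ominus>\<^bsub>Hom A X X\<^esub> ?r) v = Idm A X"
    using inv by (auto simp: invertible_mor_def)
  note [simp] = v
  have vl': "v = Idm A X \<oplus>\<^bsub>Hom A X X\<^esub> Comp A X X X v ?r"
  proof -
    have "v \<ominus>\<^bsub>Hom A X X\<^esub> Comp A X X X v ?r = Idm A X"
      using vl by (simp add: XX.minus_eq Comp_add_right Comp_minus_right Comp_Idm_right)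
    then have "Idm A X \<oplus>\<^bsub>Hom A X X\<^esub> Comp A X X X v ?r
        = (v \<ominus>\<^bsub>Hom A X X\<^esub> Comp A X X X v ?r) \<oplus>\<^bsub>Hom A X X\<^esub> Comp A X X X v ?r" by simp
    also have "\<dots> = v" by (simp add: XX.minus_eq XX.a_assoc XX.l_neg)
    finally show ?thesis by simp
  qed
  have vr': "v = Idm A X \<oplus>\<^bsub>Hom A X X\<^esub> Comp A X X X ?r v"
  proof -
    have "v \<ominus>\<^bsub>Hom A X X\<^esub> Comp A X X X ?r v = Idm A X"
      using vr by (simp add: XX.minus_eq Comp_add_left Comp_minus_left Comp_Idm_left)
    then have "Idm A X \<oplus>\<^bsub>Hom A X X\<^esub> Comp A X X X ?r v
        = (v \<ominus>\<^bsub>Hom A X X\<^esub> Comp A X X X ?r v) \<oplus>\<^bsub>Hom A X X\<^esub> Comp A X X X ?r v" by simp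
    also have "\<dots> = v" by (simp add: XX.minus_eq XX.a_assoc XX.l_neg)
    finally show ?thesis by simp
  qed
  define p where "p = Comp A Y X Y f (Comp A Y X X v g)"
  have p[simp]: "p \<in> Mor A Y Y" by (simp add: p_def)
  \<comment> \<open>Sandwiching the two equations for \<open>v\<close> between \<open>f\<close> and \<open>g\<close>.\<close>
  have pl: "p = ?q \<oplus>\<^bsub>Hom A Y Y\<^esub> Comp A Y Y Y p ?q"
  proof -
    have "p = Comp A Y X Y f (Comp A Y X X (Idm A X \<oplus>\<^bsub>Hom A X X\<^esub> Comp A X X X v ?r) g)"
      unfolding p_def by (simp only: vl'[symmetric])
    also have "\<dots> = ?q \<oplus>\<^bsub>Hom A Y Y\<^esub> Comp A Y X Y f (Comp A Y X X (Comp A X X X v ?r) g)"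
      by (simp add: Comp_add_left Comp_add_right Comp_Idm_left)
    also have "Comp A Y X Y f (Comp A Y X X (Comp A X X X v ?r) g) = Comp A Y Y Y p ?q"
      by (simp add: p_def Comp_assoc)
    finally show ?thesis .
  qed
  have pr: "p = ?q \<oplus>\<^bsub>Hom A Y Y\<^esub> Comp A Y Y Y ?q p"
  proof -
    have "p = Comp A Y X Y f (Comp A Y X X (Idm A X \<oplus>\<^bsub>Hom A X X\<^esub> Comp A X X X ?r v) g)"
      unfolding p_def by (simp only: vr'[symmetric])
    also have "\<dots> = ?q \<oplus>\<^bsub>Hom A Y Y\<^esub> Comp A Y X Y f (Comp A Y X X (Comp A X X X ?r v) g)"
      by (simp add: Comp_add_left Comp_add_right Comp_Idm_left)
    also have "Comp A Y X Y f (Comp A Y X X (Comp A X X X ?r v) g) = Comp A Y Y Y ?q p"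
      by (simp add: p_def Comp_assoc)
    finally show ?thesis .
  qed
  let ?w = "Idm A Y \<oplus>\<^bsub>Hom A Y Y\<^esub> p"
  have "Comp A Y Y Y ?w (Idm A Y \<ominus>\<^bsub>Hom A Y Y\<^esub> ?q)
      = ?w \<ominus>\<^bsub>Hom A Y Y\<^esub> (?q \<oplus>\<^bsub>Hom A Y Y\<^esub> Comp A Y Y Y p ?q)"
    by (simp add: YY.minus_eq Comp_add_right Comp_minus_right Comp_Idm_right
        Comp_add_left Comp_Idm_left)
  also have "\<dots> = Idm A Y"
    by (simp only: pl[symmetric]) (simp add: YY.minus_eq YY.a_assoc YY.r_neg)
  finally have 1: "Comp A Y Y Y ?w (Idm A Y \<ominus>\<^bsub>Hom A Y Y\<^esub> ?q) = Idm A Y" .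
  have "Comp A Y Y Y (Idm A Y \<ominus>\<^bsub>Hom A Y Y\<^esub> ?q) ?w
      = ?w \<ominus>\<^bsub>Hom A Y Y\<^esub> (?q \<oplus>\<^bsub>Hom A Y Y\<^esub> Comp A Y Y Y ?q p)"
    by (simp add: YY.minus_eq Comp_add_left Comp_minus_left Comp_Idm_right
        Comp_add_right Comp_Idm_left YY.minus_add YY.a_ac)
  also have "\<dots> = Idm A Y"
    by (simp only: pr[symmetric]) (simp add: YY.minus_eq YY.a_assoc YY.r_neg)
  finally have 2: "Comp A Y Y Y (Idm A Y \<ominus>\<^bsub>Hom A Y Y\<^esub> ?q) ?w = Idm A Y" .
  have "?w \<in> Mor A Y Y" "Idm A Y \<ominus>\<^bsub>Hom A Y Y\<^esub> ?q \<in> Mor A Y Y"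
    by (simp_all add: YY.minus_eq)
  with 1 2 show ?thesis unfolding invertible_mor_def by blast
qed

lemma rad_in_Mor: "f \<in> rad A X Y \<Longrightarrow> f \<in> Mor A X Y"
  by (simp add: rad_def)

lemma zero_in_rad:
  assumes "X \<in> Ob A" "Y \<in> Ob A"
  shows "\<zero>\<^bsub>Hom A X Y\<^esub> \<in> rad A X Y"
proof -
  interpret XX: abelian_group "Hom A X X" using assms by (simp add: Hom_abelian_group)
  interpret XY: abelian_group "Hom A X Y" using assms by (simp add: Hom_abelian_group)
  have "invertible_mor A X X (Idm A X)"
    using assms by (auto simp: invertible_mor_def Idm_closed Comp_Idm_left)
  moreover have "Idm A X \<ominus>\<^bsub>Hom A X X\<^esub> \<zero>\<^bsub>Hom A X X\<^esub> = Idm A X"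
    unfolding XX.minus_eq using XX.minus_equality[OF XX.l_zero] assms
    by (simp only: XX.r_zero Idm_closed XX.zero_closed)
  ultimately show ?thesis
    using assms by (simp add: rad_def Comp_zero_right)
qed

lemma rad_Comp_left:
  assumes ob: "X \<in> Ob A" "Y \<in> Ob A" "Z \<in> Ob A"
    and f: "f \<in> rad A X Y" and h: "h \<in> Mor A Y Z"
  shows "Comp A X Y Z h f \<in> rad A X Z"
  unfolding rad_def
proof (intro CollectI conjI ballI)
  show "Comp A X Y Z h f \<in> Mor A X Z" using ob h rad_in_Mor[OF f] by (simp add: Comp_closed)
  fix g assume g: "g \<in> Mor A Z X"
  have "Comp A X Z X g (Comp A X Y Z h f) = Comp A X Y X (Comp A Y Z X g h) f"
    using ob g h rad_in_Mor[OF f] by (simp add: Comp_assoc)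
  then show "invertible_mor A X X (Idm A X \<ominus>\<^bsub>Hom A X X\<^esub> Comp A X Z X g (Comp A X Y Z h f))"
    using f ob g h by (simp add: rad_def Comp_closed)
qed

text \<open>
  The definition of the radical tests \<open>1 - gf\<close> at the source, so enlarging \<open>f\<close> on the source side
  requires moving the test to the old source with \<open>invertible_Idm_minus_swap\<close>.
\<close>

lemma rad_Comp_right:
  assumes ob: "W \<in> Ob A" "X \<in> Ob A" "Y \<in> Ob A"
    and f: "f \<in> rad A X Y" and h: "h \<in> Mor A W X"
  shows "Comp A W X Y f h \<in> rad A W Y"
  unfolding rad_def
proof (intro CollectI conjI ballI)
  note fM = rad_in_Mor[OF f]
  show "Comp A W X Y f h \<in> Mor A W Y" using ob h fM by (simp add: Comp_closed)
  fix g assume g: "g \<in> Mor A Y W"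
  have "invertible_mor A X X (Idm A X \<ominus>\<^bsub>Hom A X X\<^esub> Comp A X Y X (Comp A Y W X h g) f)"
    using f ob g h by (simp add: rad_def Comp_closed)
  then have "invertible_mor A X X (Idm A X \<ominus>\<^bsub>Hom A X X\<^esub> Comp A X W X h (Comp A X Y W g f))"
    using ob g h fM by (simp add: Comp_assoc)
  then have "invertible_mor A W W (Idm A W \<ominus>\<^bsub>Hom A W W\<^esub> Comp A W X W (Comp A X Y W g f) h)"
    using ob g h fM invertible_Idm_minus_swap[of X W "Comp A X Y W g f" h]
    by (simp add: Comp_closed)
  then show "invertible_mor A W W (Idm A W \<ominus>\<^bsub>Hom A W W\<^esub> Comp A W Y W g (Comp A W X Y f h))"
    using ob g h fM by (simp add: Comp_assoc)
qed

lemma rad_add: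
  assumes ob: "X \<in> Ob A" "Y \<in> Ob A" and f: "f \<in> rad A X Y" and f': "f' \<in> rad A X Y"
  shows "f \<oplus>\<^bsub>Hom A X Y\<^esub> f' \<in> rad A X Y"
  unfolding rad_def
proof (intro CollectI conjI ballI)
  interpret XX: abelian_group "Hom A X X" using ob by (simp add: Hom_abelian_group)
  interpret XY: abelian_group "Hom A X Y" using ob by (simp add: Hom_abelian_group)
  note [simp] = ob rad_in_Mor[OF f] rad_in_Mor[OF f'] Comp_closed Idm_closed
  show "f \<oplus>\<^bsub>Hom A X Y\<^esub> f' \<in> Mor A X Y" by simp
  fix g assume g[simp]: "g \<in> Mor A Y X"
  let ?u = "Idm A X \<ominus>\<^bsub>Hom A X X\<^esub> Comp A X Y X g f"
  have u: "invertible_mor A X X ?u" using f by (simp add: rad_def)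
  then obtain v where v[simp]: "v \<in> Mor A X X" and uv: "Comp A X X X ?u v = Idm A X"
    by (auto simp: invertible_mor_def)
  have [simp]: "?u \<in> Mor A X X" by (simp add: XX.minus_eq)
  \<comment> \<open>Factor \<open>1 - g(f + f') = u(1 - vgf')\<close> where \<open>u = 1 - gf\<close> and \<open>v\<close> is its inverse.\<close>
  let ?u' = "Idm A X \<ominus>\<^bsub>Hom A X X\<^esub> Comp A X Y X (Comp A Y X X v g) f'"
  have u': "invertible_mor A X X ?u'" using f' by (simp add: rad_def)
  have "Comp A X X X ?u (Comp A X Y X (Comp A Y X X v g) f')
      = Comp A X Y X (Comp A Y X X (Comp A X X X ?u v) g) f'"
    by (simp add: Comp_assoc del: uv)
  also have "\<dots> = Comp A X Y X g f'" by (simp add: uv Comp_Idm_left)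
  finally have *: "Comp A X X X ?u (Comp A X Y X (Comp A Y X X v g) f') = Comp A X Y X g f'" .
  have "Comp A X X X ?u ?u' = ?u \<ominus>\<^bsub>Hom A X X\<^esub> Comp A X Y X g f'"
  proof -
    have "Comp A X X X ?u ?u' = Comp A X X X ?u (Idm A X) \<oplus>\<^bsub>Hom A X X\<^esub>
        \<ominus>\<^bsub>Hom A X X\<^esub> Comp A X X X ?u (Comp A X Y X (Comp A Y X X v g) f')"
      unfolding XX.minus_eq[of "Idm A X" "Comp A X Y X (Comp A Y X X v g) f'"]
      by (simp only: Comp_add_right Comp_minus_right ob \<open>?u \<in> Mor A X X\<close> Idm_closed
          XX.a_inv_closed Comp_closed v g rad_in_Mor[OF f'])
    then show ?thesis using * by (simp add: Comp_Idm_right XX.minus_eq)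
  qed
  also have "\<dots> = Idm A X \<ominus>\<^bsub>Hom A X X\<^esub> Comp A X Y X g (f \<oplus>\<^bsub>Hom A X Y\<^esub> f')"
    by (simp add: XX.minus_eq Comp_add_right XX.minus_add XX.a_assoc)
  finally show "invertible_mor A X X
      (Idm A X \<ominus>\<^bsub>Hom A X X\<^esub> Comp A X Y X g (f \<oplus>\<^bsub>Hom A X Y\<^esub> f'))"
    using invertible_Comp[OF ob(1) ob(1) ob(1) u' u] by simp
qed

lemma invertible_if_rad_complement:
  assumes ob: "X \<in> Ob A" and u: "u \<in> Mor A X X" and c: "c \<in> rad A X X"
    and eq: "u \<oplus>\<^bsub>Hom A X X\<^esub> c = Idm A X"
  shows "invertible_mor A X X u"
proof -
  interpret XX: abelian_group "Hom A X X" using ob by (simp add: Hom_abelian_group)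
  note cM = rad_in_Mor[OF c]
  have "Idm A X \<ominus>\<^bsub>Hom A X X\<^esub> Comp A X X X (Idm A X) c = u"
    unfolding Comp_Idm_left[OF ob ob cM]
    using u cM by (simp add: XX.minus_eq eq[symmetric] XX.a_assoc XX.r_neg)
  moreover have "invertible_mor A X X (Idm A X \<ominus>\<^bsub>Hom A X X\<^esub> Comp A X X X (Idm A X) c)"
    using c ob by (simp add: rad_def Idm_closed)
  ultimately show ?thesis by simp
qed

text \<open>
  These two lemmas serve twice: for \<open>c\<close> in the ideal they reflect one-sided inverses along the
  quotient functor, and for \<open>c\<close> a composite through a discarded summand they show that the
  remaining summand already splits.
\<close>

lemma retraction_if_modulo_rad:
  assumes ob: "Z \<in> Ob A" "Y \<in> Ob A" and h: "h \<in> Mor A Z Y" and s: "s \<in> Mor A Y Z"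
    and c: "c \<in> rad A Y Y" and eq: "Comp A Y Z Y h s \<oplus>\<^bsub>Hom A Y Y\<^esub> c = Idm A Y"
  shows "retraction_mor A Z Y h"
proof -
  have "invertible_mor A Y Y (Comp A Y Z Y h s)"
    using invertible_if_rad_complement[OF ob(2) _ c eq] ob h s by (simp add: Comp_closed)
  then obtain v where v: "v \<in> Mor A Y Y" "Comp A Y Y Y (Comp A Y Z Y h s) v = Idm A Y"
    by (auto simp: invertible_mor_def)
  then have "Comp A Y Z Y h (Comp A Y Y Z s v) = Idm A Y"
    using ob h s by (simp add: Comp_assoc)
  then show ?thesis
    unfolding retraction_mor_def using ob h s v Comp_closed by blast
qed

lemma section_if_modulo_rad:
  assumes ob: "X \<in> Ob A" "Z \<in> Ob A" and g: "g \<in> Mor A X Z" and s: "s \<in> Mor A Z X"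
    and c: "c \<in> rad A X X" and eq: "Comp A X Z X s g \<oplus>\<^bsub>Hom A X X\<^esub> c = Idm A X"
  shows "section_mor A X Z g"
proof -
  have "invertible_mor A X X (Comp A X Z X s g)"
    using invertible_if_rad_complement[OF ob(1) _ c eq] ob g s by (simp add: Comp_closed)
  then obtain v where v: "v \<in> Mor A X X" "Comp A X X X v (Comp A X Z X s g) = Idm A X"
    by (auto simp: invertible_mor_def)
  then have "Comp A X Z X (Comp A Z X X v s) g = Idm A X"
    using ob g s by (simp add: Comp_assoc)
  then show ?thesis
    unfolding section_mor_def using ob g s v Comp_closed by blast
qed

end


section \<open>The square of the radical\<close>

definition rad_composites :: "('k, 'o, 'm) k_cat \<Rightarrow> 'o \<Rightarrow> 'o \<Rightarrow> 'm set" where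
  "rad_composites A X Y =
     {Comp A X Z Y h g | Z g h. Z \<in> Ob A \<and> g \<in> rad A X Z \<and> h \<in> rad A Z Y}"

lemma finsum_in_additive_subset:
  fixes G (structure)
  assumes G: "abelian_monoid G" and fin: "finite F"
    and T: "T \<subseteq> carrier G" "\<zero> \<in> T" "\<And>x y. \<lbrakk>x \<in> T; y \<in> T\<rbrakk> \<Longrightarrow> x \<oplus> y \<in> T"
    and u: "\<And>i. i \<in> F \<Longrightarrow> u i \<in> T"
  shows "finsum G u F \<in> T"
proof -
  interpret abelian_monoid G by fact
  show ?thesis using fin u
  proof (induction F rule: finite_induct)
    case (insert i F)
    then have "finsum G u (insert i F) = u i \<oplus> finsum G u F"
      using T(1) by (intro finsum_insert) auto
    then show ?case using insert T(3) by simp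
  qed (simp add: T(2))
qed

context k_category
begin

text \<open>
  Composites along \<open>row \<circ> column\<close> through a direct sum only use how the projections compose with
  the injections.
\<close>

lemma biproduct_sum_of_composites:
  assumes ob: "X \<in> Ob A" "Y \<in> Ob A" "Z \<in> Ob A" "W \<in> Ob A"
  obtains S i j p q where "S \<in> Ob A"
    and "i \<in> Mor A Z S" "j \<in> Mor A W S" "p \<in> Mor A S Z" "q \<in> Mor A S W"
    and "\<And>g h a b. \<lbrakk>g \<in> Mor A X Z; h \<in> Mor A Z Y; a \<in> Mor A X W; b \<in> Mor A W Y\<rbrakk> \<Longrightarrow>
      Comp A X S Y (Comp A S Z Y h p \<oplus>\<^bsub>Hom A S Y\<^esub> Comp A S W Y b q)
                   (Comp A X Z S i g \<oplus>\<^bsub>Hom A X S\<^esub> Comp A X W S j a)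
      = Comp A X Z Y h g \<oplus>\<^bsub>Hom A X Y\<^esub> Comp A X W Y b a"
proof -
  obtain S where "direct_sum A S [Z, W]" using ex_direct_sum ob by blast
  then obtain \<iota> \<pi> where S: "S \<in> Ob A"
    and m: "\<forall>i<2. \<iota> i \<in> Mor A ([Z, W] ! i) S \<and> \<pi> i \<in> Mor A S ([Z, W] ! i)"
    and d: "\<forall>i<2. \<forall>j<2. Comp A ([Z, W] ! j) S ([Z, W] ! i) (\<pi> i) (\<iota> j) =
            (if i = j then Idm A ([Z, W] ! i) else \<zero>\<^bsub>Hom A ([Z, W] ! j) ([Z, W] ! i)\<^esub>)"
    unfolding direct_sum_def by (auto simp: numeral_2_eq_2)
  define i j p q where ijpq: "i = \<iota> 0" "j = \<iota> 1" "p = \<pi> 0" "q = \<pi> 1"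
  have M: "i \<in> Mor A Z S" "j \<in> Mor A W S" "p \<in> Mor A S Z" "q \<in> Mor A S W"
    unfolding ijpq using m[rule_format, of 0] m[rule_format, of 1] by auto
  have D: "Comp A Z S Z p i = Idm A Z" "Comp A W S W q j = Idm A W"
    "Comp A W S Z p j = \<zero>\<^bsub>Hom A W Z\<^esub>" "Comp A Z S W q i = \<zero>\<^bsub>Hom A Z W\<^esub>"
    unfolding ijpq using d[rule_format, of 0 0] d[rule_format, of 1 1] d[rule_format, of 0 1]
      d[rule_format, of 1 0] by auto
  note [simp] = ob S M Comp_closed
  have "Comp A X S Y (Comp A S Z Y h p \<oplus>\<^bsub>Hom A S Y\<^esub> Comp A S W Y b q)
                   (Comp A X Z S i g \<oplus>\<^bsub>Hom A X S\<^esub> Comp A X W S j a)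
      = Comp A X Z Y h g \<oplus>\<^bsub>Hom A X Y\<^esub> Comp A X W Y b a"
    if [simp]: "g \<in> Mor A X Z" "h \<in> Mor A Z Y" "a \<in> Mor A X W" "b \<in> Mor A W Y" for g h a b
  proof -
    interpret SY: abelian_group "Hom A S Y" by (simp add: Hom_abelian_group)
    interpret XS: abelian_group "Hom A X S" by (simp add: Hom_abelian_group)
    interpret XY: abelian_group "Hom A X Y" by (simp add: Hom_abelian_group)
    have c: "Comp A X S Y (Comp A S U Y r s) (Comp A X V S t w)
        = Comp A X U Y r (Comp A X V U (Comp A V S U s t) w)"
      if "U \<in> Ob A" "V \<in> Ob A" "r \<in> Mor A U Y" "s \<in> Mor A S U" "t \<in> Mor A V S" "w \<in> Mor A X V"
      for U V r s t w using that by (simp add: Comp_assoc)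
    show ?thesis
      by (simp add: Comp_add_left Comp_add_right c D Comp_Idm_left Comp_zero_left Comp_zero_right)
  qed
  with S M show thesis using that by blast
qed

text \<open>
  A sum of two composites \<open>ba\<close> and \<open>b'a'\<close> is the composite of the column \<open>(a, a')\<close> and the row
  \<open>(b, b')\<close>, so no sums are needed to generate \<open>rad\<^sup>2\<close>.
\<close>

lemma rad_composites_submodule:
  assumes ob: "X \<in> Ob A" "Y \<in> Ob A"
  shows "submodule (rad_composites A X Y) k (Hom A X Y)"
proof -
  interpret M: module k "Hom A X Y" using ob by (rule Hom_module)
  have closed: "rad_composites A X Y \<subseteq> Mor A X Y"
    using ob by (auto simp: rad_composites_def intro!: Comp_closed dest: rad_in_Mor)
  have smult: "r \<odot>\<^bsub>Hom A X Y\<^esub> c \<in> rad_composites A X Y"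
    if r: "r \<in> carrier k" and c: "c \<in> rad_composites A X Y" for r c
  proof -
    obtain W a b where W: "W \<in> Ob A" and a: "a \<in> rad A X W" and b: "b \<in> rad A W Y"
      and c: "c = Comp A X W Y b a" using c by (auto simp: rad_composites_def)
    interpret XW: module k "Hom A X W" using ob W by (simp add: Hom_module)
    interpret WW: module k "Hom A W W" using W by (simp add: Hom_module)
    have "r \<odot>\<^bsub>Hom A X W\<^esub> a = Comp A X W W (r \<odot>\<^bsub>Hom A W W\<^esub> Idm A W) a"
      using ob W r rad_in_Mor[OF a] by (simp add: Comp_smult_left Idm_closed Comp_Idm_left)
    then have "r \<odot>\<^bsub>Hom A X W\<^esub> a \<in> rad A X W"
      using rad_Comp_left[OF ob(1) W W a] W r by (simp add: Idm_closed)
    moreover have "r \<odot>\<^bsub>Hom A X Y\<^esub> c = Comp A X W Y b (r \<odot>\<^bsub>Hom A X W\<^esub> a)"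
      using ob W r rad_in_Mor[OF a] rad_in_Mor[OF b] c by (simp add: Comp_smult_right)
    ultimately show ?thesis using W b by (auto simp: rad_composites_def)
  qed
  have add: "c \<oplus>\<^bsub>Hom A X Y\<^esub> c' \<in> rad_composites A X Y"
    if cS: "c \<in> rad_composites A X Y" and cS': "c' \<in> rad_composites A X Y" for c c'
  proof -
    obtain Z a b where Z: "Z \<in> Ob A" and a: "a \<in> rad A X Z" and b: "b \<in> rad A Z Y"
      and c: "c = Comp A X Z Y b a" using cS unfolding rad_composites_def by blast
    obtain W a' b' where W: "W \<in> Ob A" and a': "a' \<in> rad A X W" and b': "b' \<in> rad A W Y"
      and c': "c' = Comp A X W Y b' a'" using cS' unfolding rad_composites_def by blast
    obtain S i j p q where S: "S \<in> Ob A"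
      and m: "i \<in> Mor A Z S" "j \<in> Mor A W S" "p \<in> Mor A S Z" "q \<in> Mor A S W"
      and eq: "\<And>g h a b. \<lbrakk>g \<in> Mor A X Z; h \<in> Mor A Z Y; a \<in> Mor A X W; b \<in> Mor A W Y\<rbrakk> \<Longrightarrow>
      Comp A X S Y (Comp A S Z Y h p \<oplus>\<^bsub>Hom A S Y\<^esub> Comp A S W Y b q)
                   (Comp A X Z S i g \<oplus>\<^bsub>Hom A X S\<^esub> Comp A X W S j a)
      = Comp A X Z Y h g \<oplus>\<^bsub>Hom A X Y\<^esub> Comp A X W Y b a"
      using biproduct_sum_of_composites[OF ob Z W] by blast
    have "Comp A S Z Y b p \<oplus>\<^bsub>Hom A S Y\<^esub> Comp A S W Y b' q \<in> rad A S Y"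
      using ob Z W S m b b' by (intro rad_add rad_Comp_right)
    moreover have "Comp A X Z S i a \<oplus>\<^bsub>Hom A X S\<^esub> Comp A X W S j a' \<in> rad A X S"
      using ob Z W S m a a' by (intro rad_add rad_Comp_left)
    moreover note eq[OF rad_in_Mor[OF a] rad_in_Mor[OF b] rad_in_Mor[OF a'] rad_in_Mor[OF b'],
        symmetric]
    ultimately show ?thesis using S unfolding c c' rad_composites_def by blast
  qed
  have zero: "\<zero>\<^bsub>Hom A X Y\<^esub> \<in> rad_composites A X Y"
  proof -
    have "\<zero>\<^bsub>Hom A X Y\<^esub> = Comp A X X Y \<zero>\<^bsub>Hom A X Y\<^esub> \<zero>\<^bsub>Hom A X X\<^esub>"
      using ob rad_in_Mor zero_in_rad by (simp add: Comp_zero_left)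
    then show ?thesis using ob zero_in_rad unfolding rad_composites_def by blast
  qed
  have neg: "\<ominus>\<^bsub>Hom A X Y\<^esub> c \<in> rad_composites A X Y" if "c \<in> rad_composites A X Y" for c
  proof -
    have "\<ominus>\<^bsub>Hom A X Y\<^esub> c = (\<ominus>\<^bsub>k\<^esub> \<one>\<^bsub>k\<^esub>) \<odot>\<^bsub>Hom A X Y\<^esub> c"
      using that closed M.smult_l_minus[of "\<one>\<^bsub>k\<^esub>" c] by auto
    then show ?thesis using smult[OF _ that] by simp
  qed
  show ?thesis
    by (rule M.submoduleI) (use closed add zero neg smult in auto)
qed

lemma rad_square_eq_composites:
  assumes "X \<in> Ob A" "Y \<in> Ob A"
  shows "rad_square k A X Y = rad_composites A X Y"
  unfolding rad_square_def rad_composites_def[symmetric]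
  by (rule hull_same) (rule rad_composites_submodule[OF assms])

lemma rad_square_subset_rad:
  assumes "X \<in> Ob A" "Y \<in> Ob A"
  shows "rad_square k A X Y \<subseteq> rad A X Y"
  using assms unfolding rad_square_eq_composites[OF assms] rad_composites_def
  by (auto intro!: rad_Comp_right dest: rad_in_Mor)

lemma rad_square_Comp_left:
  assumes ob: "X \<in> Ob A" "Y \<in> Ob A" "Z \<in> Ob A"
    and c: "c \<in> rad_square k A X Y" and h: "h \<in> Mor A Y Z"
  shows "Comp A X Y Z h c \<in> rad_square k A X Z"
proof -
  obtain W a b where W: "W \<in> Ob A" "a \<in> rad A X W" "b \<in> rad A W Y" "c = Comp A X W Y b a"
    using c ob by (auto simp: rad_square_eq_composites rad_composites_def)
  then have "Comp A X Y Z h c = Comp A X W Z (Comp A W Y Z h b) a"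
    using ob h by (simp add: Comp_assoc rad_in_Mor)
  then show ?thesis
    using W ob h rad_Comp_left[of W Y Z b h]
    by (auto simp: rad_square_eq_composites rad_composites_def)
qed

lemma rad_square_Comp_right:
  assumes ob: "W \<in> Ob A" "X \<in> Ob A" "Y \<in> Ob A"
    and c: "c \<in> rad_square k A X Y" and h: "h \<in> Mor A W X"
  shows "Comp A W X Y c h \<in> rad_square k A W Y"
proof -
  obtain V a b where V: "V \<in> Ob A" "a \<in> rad A X V" "b \<in> rad A V Y" "c = Comp A X V Y b a"
    using c ob by (auto simp: rad_square_eq_composites rad_composites_def)
  then have "Comp A W X Y c h = Comp A W V Y b (Comp A W X V a h)"
    using ob h by (simp add: Comp_assoc rad_in_Mor)
  then show ?thesis
    using V ob h rad_Comp_right[of W X V a h]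
    by (auto simp: rad_square_eq_composites rad_composites_def)
qed

lemma rad_square_add_closed:
  assumes "X \<in> Ob A" "Y \<in> Ob A" "c \<in> rad_square k A X Y" "d \<in> rad_square k A X Y"
  shows "c \<oplus>\<^bsub>Hom A X Y\<^esub> d \<in> rad_square k A X Y"
  using subgroup.m_closed[OF submodule.axioms(1)[OF rad_composites_submodule[OF assms(1,2)]]] assms
  by (simp add: rad_square_eq_composites)

lemma rad_square_zero:
  assumes "X \<in> Ob A" "Y \<in> Ob A"
  shows "\<zero>\<^bsub>Hom A X Y\<^esub> \<in> rad_square k A X Y"
  using subgroup.one_closed[OF submodule.axioms(1)[OF rad_composites_submodule[OF assms]]] assms
  by (simp add: rad_square_eq_composites)

text \<open>
  The endomorphisms \<open>u\<close> of \<open>X\<close> with \<open>fu\<close> in \<open>rad\<^sup>2\<close> are closed under sums and contain every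
  \<open>\<iota>\<^sub>i\<pi>\<^sub>i\<close>, so they contain the identity.
\<close>

lemma rad_square_if_source_components:
  assumes X: "direct_sum A X Xs" and Y: "Y \<in> Ob A" and f: "f \<in> Mor A X Y"
    and comp: "\<And>U \<iota>. \<lbrakk>U \<in> set Xs; \<iota> \<in> Mor A U X\<rbrakk> \<Longrightarrow> Comp A U X Y f \<iota> \<in> rad_square k A U Y"
  shows "f \<in> rad_square k A X Y"
proof -
  obtain \<iota> \<pi> where ob: "X \<in> Ob A" "set Xs \<subseteq> Ob A"
    and m: "\<forall>i<length Xs. \<iota> i \<in> Mor A (Xs ! i) X \<and> \<pi> i \<in> Mor A X (Xs ! i)"
    and sum: "(\<Oplus>\<^bsub>Hom A X X\<^esub>i\<in>{..<length Xs}. Comp A X (Xs ! i) X (\<iota> i) (\<pi> i)) = Idm A X"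
    using X unfolding direct_sum_def by blast
  interpret XX: abelian_group "Hom A X X" using ob by (simp add: Hom_abelian_group)
  let ?T = "{u \<in> Mor A X X. Comp A X X Y f u \<in> rad_square k A X Y}"
  have "finsum (Hom A X X) (\<lambda>i. Comp A X (Xs ! i) X (\<iota> i) (\<pi> i)) {..<length Xs} \<in> ?T"
  proof (rule finsum_in_additive_subset[OF XX.abelian_monoid_axioms])
    show "\<zero>\<^bsub>Hom A X X\<^esub> \<in> ?T"
      using ob Y f by (simp add: Comp_zero_right rad_square_zero)
    show "x \<oplus>\<^bsub>Hom A X X\<^esub> y \<in> ?T" if "x \<in> ?T" "y \<in> ?T" for x y
      using that ob Y f by (simp add: Comp_add_right rad_square_add_closed)
    fix i assume "i \<in> {..<length Xs}"
    then have i: "Xs ! i \<in> set Xs" "Xs ! i \<in> Ob A" "\<iota> i \<in> Mor A (Xs ! i) X" "\<pi> i \<in> Mor A X (Xs ! i)"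
      using m ob by auto
    have "Comp A X (Xs ! i) Y (Comp A (Xs ! i) X Y f (\<iota> i)) (\<pi> i) \<in> rad_square k A X Y"
      using rad_square_Comp_right[OF ob(1) i(2) Y comp[OF i(1,3)] i(4)] .
    then show "Comp A X (Xs ! i) X (\<iota> i) (\<pi> i) \<in> ?T"
      using i ob Y f by (simp add: Comp_assoc Comp_closed)
  qed auto
  then show ?thesis using sum ob Y f by (simp add: Comp_Idm_right)
qed

lemma rad_square_if_target_components:
  assumes X: "X \<in> Ob A" and Y: "direct_sum A Y Ys" and f: "f \<in> Mor A X Y"
    and comp: "\<And>V \<pi>. \<lbrakk>V \<in> set Ys; \<pi> \<in> Mor A Y V\<rbrakk> \<Longrightarrow> Comp A X Y V \<pi> f \<in> rad_square k A X V"
  shows "f \<in> rad_square k A X Y"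
proof -
  obtain \<iota> \<pi> where ob: "Y \<in> Ob A" "set Ys \<subseteq> Ob A"
    and m: "\<forall>i<length Ys. \<iota> i \<in> Mor A (Ys ! i) Y \<and> \<pi> i \<in> Mor A Y (Ys ! i)"
    and sum: "(\<Oplus>\<^bsub>Hom A Y Y\<^esub>i\<in>{..<length Ys}. Comp A Y (Ys ! i) Y (\<iota> i) (\<pi> i)) = Idm A Y"
    using Y unfolding direct_sum_def by blast
  interpret YY: abelian_group "Hom A Y Y" using ob by (simp add: Hom_abelian_group)
  let ?T = "{u \<in> Mor A Y Y. Comp A X Y Y u f \<in> rad_square k A X Y}"
  have "finsum (Hom A Y Y) (\<lambda>i. Comp A Y (Ys ! i) Y (\<iota> i) (\<pi> i)) {..<length Ys} \<in> ?T"
  proof (rule finsum_in_additive_subset[OF YY.abelian_monoid_axioms])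
    show "\<zero>\<^bsub>Hom A Y Y\<^esub> \<in> ?T"
      using ob X f by (simp add: Comp_zero_left rad_square_zero)
    show "x \<oplus>\<^bsub>Hom A Y Y\<^esub> y \<in> ?T" if "x \<in> ?T" "y \<in> ?T" for x y
      using that ob X f by (simp add: Comp_add_left rad_square_add_closed)
    fix i assume "i \<in> {..<length Ys}"
    then have i: "Ys ! i \<in> set Ys" "Ys ! i \<in> Ob A" "\<iota> i \<in> Mor A (Ys ! i) Y" "\<pi> i \<in> Mor A Y (Ys ! i)"
      using m ob by auto
    have "Comp A X (Ys ! i) Y (\<iota> i) (Comp A X Y (Ys ! i) (\<pi> i) f) \<in> rad_square k A X Y"
      using rad_square_Comp_left[OF X i(2) ob(1) comp[OF i(1,4)] i(3)] .
    then show "Comp A Y (Ys ! i) Y (\<iota> i) (\<pi> i) \<in> ?T"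
      using i ob X f by (simp add: Comp_assoc Comp_closed)
  qed auto
  then show ?thesis using sum ob X f by (simp add: Comp_Idm_left)
qed

text \<open>
  Admissibility speaks about indecomposables only; the two preceding lemmas extend it to finite
  direct sums of them.
\<close>

lemma ideal_subset_rad_square:
  assumes I: "admissible_ideal k A I"
    and X: "direct_sum A X Xs" "\<forall>U\<in>set Xs. indecomposable A U \<and> Idm A U \<notin> I U U"
    and Y: "direct_sum A Y Ys" "\<forall>V\<in>set Ys. indecomposable A V \<and> Idm A V \<notin> I V V"
  shows "I X Y \<subseteq> rad_square k A X Y"
proof
  fix c assume c: "c \<in> I X Y"
  have ob: "X \<in> Ob A" "set Xs \<subseteq> Ob A" "Y \<in> Ob A" "set Ys \<subseteq> Ob A"
    using X(1) Y(1) by (auto simp: direct_sum_def)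
  have idl: "\<And>X Y Z f g. \<lbrakk>X \<in> Ob A; Y \<in> Ob A; Z \<in> Ob A; f \<in> I X Y; g \<in> Mor A Y Z\<rbrakk>
        \<Longrightarrow> Comp A X Y Z g f \<in> I X Z"
    and idr: "\<And>X Y Z f g. \<lbrakk>X \<in> Ob A; Y \<in> Ob A; Z \<in> Ob A; f \<in> Mor A X Y; g \<in> I Y Z\<rbrakk>
        \<Longrightarrow> Comp A X Y Z g f \<in> I X Z"
    and sub: "\<And>X Y. \<lbrakk>X \<in> Ob A; Y \<in> Ob A\<rbrakk> \<Longrightarrow> submodule (I X Y) k (Hom A X Y)"
    using I by (simp_all add: admissible_ideal_def ideal_of_def)
  have sub: "\<And>X Y c. \<lbrakk>X \<in> Ob A; Y \<in> Ob A; c \<in> I X Y\<rbrakk> \<Longrightarrow> c \<in> Mor A X Y"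
    using module.submoduleE(1)[OF Hom_module sub] by blast
  have sq: "\<And>U V. \<lbrakk>U \<in> set Xs; V \<in> set Ys\<rbrakk> \<Longrightarrow> I U V \<subseteq> rad_square k A U V"
    using I X(2) Y(2) by (simp add: admissible_ideal_def)
  show "c \<in> rad_square k A X Y"
  proof (rule rad_square_if_source_components[OF X(1) ob(3)])
    show "c \<in> Mor A X Y" using sub[OF ob(1,3) c] .
    fix U \<iota> assume U: "U \<in> set Xs" "\<iota> \<in> Mor A U X"
    have UO: "U \<in> Ob A" using U ob by blast
    have cU: "Comp A U X Y c \<iota> \<in> I U Y" using idr[OF UO ob(1,3) U(2) c] .
    show "Comp A U X Y c \<iota> \<in> rad_square k A U Y"
    proof (rule rad_square_if_target_components[OF UO Y(1)])
      show "Comp A U X Y c \<iota> \<in> Mor A U Y" using sub[OF UO ob(3) cU] .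
      fix V \<pi> assume V: "V \<in> set Ys" "\<pi> \<in> Mor A Y V"
      then have "Comp A U Y V \<pi> (Comp A U X Y c \<iota>) \<in> I U V"
        using idl[OF UO ob(3) _ cU] ob(4) by blast
      then show "Comp A U Y V \<pi> (Comp A U X Y c \<iota>) \<in> rad_square k A U V"
        using sq U(1) V(1) by blast
    qed
  qed
qed

text \<open>
  An element of \<open>rad\<^sup>2\<close> can be absorbed into a factorisation by enlarging the middle object.  The
  added summand cannot be responsible for the splitting that irreducibility provides, since both
  morphisms through it are radical; this is where \<open>rad\<^sup>2\<close> instead of \<open>rad\<close> matters.
\<close>

lemma irreducible_factor_modulo_rad_square:
  assumes irr: "irreducible_mor A X Y f"
    and ob: "X \<in> Ob A" "Y \<in> Ob A" "Z \<in> Ob A"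
    and g: "g \<in> Mor A X Z" and h: "h \<in> Mor A Z Y"
    and c: "c \<in> rad_square k A X Y" and f: "f = Comp A X Z Y h g \<oplus>\<^bsub>Hom A X Y\<^esub> c"
  shows "retraction_mor A Z Y h \<or> section_mor A X Z g"
proof -
  obtain W a b where W: "W \<in> Ob A" and a: "a \<in> rad A X W" and b: "b \<in> rad A W Y"
    and c: "c = Comp A X W Y b a"
    using c ob by (auto simp: rad_square_eq_composites rad_composites_def)
  note aM = rad_in_Mor[OF a] and bM = rad_in_Mor[OF b]
  obtain S i j p q where S: "S \<in> Ob A"
    and m: "i \<in> Mor A Z S" "j \<in> Mor A W S" "p \<in> Mor A S Z" "q \<in> Mor A S W"
    and eq: "\<And>g h a b. \<lbrakk>g \<in> Mor A X Z; h \<in> Mor A Z Y; a \<in> Mor A X W; b \<in> Mor A W Y\<rbrakk> \<Longrightarrow>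
      Comp A X S Y (Comp A S Z Y h p \<oplus>\<^bsub>Hom A S Y\<^esub> Comp A S W Y b q)
                   (Comp A X Z S i g \<oplus>\<^bsub>Hom A X S\<^esub> Comp A X W S j a)
      = Comp A X Z Y h g \<oplus>\<^bsub>Hom A X Y\<^esub> Comp A X W Y b a"
    using biproduct_sum_of_composites[OF ob W] by blast
  interpret SY: abelian_group "Hom A S Y" using S ob by (simp add: Hom_abelian_group)
  interpret XS: abelian_group "Hom A X S" using S ob by (simp add: Hom_abelian_group)
  let ?row = "Comp A S Z Y h p \<oplus>\<^bsub>Hom A S Y\<^esub> Comp A S W Y b q"
  let ?col = "Comp A X Z S i g \<oplus>\<^bsub>Hom A X S\<^esub> Comp A X W S j a"
  note [simp] = ob W S m g h aM bM Comp_closed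
  have "?row \<in> Mor A S Y" "?col \<in> Mor A X S" "f = Comp A X S Y ?row ?col"
    using eq[OF g h aM bM] f c by simp_all
  then have "retraction_mor A S Y ?row \<or> section_mor A X S ?col"
    using irr S unfolding irreducible_mor_def by blast
  then show ?thesis
  proof
    assume "retraction_mor A S Y ?row"
    then obtain s where s[simp]: "s \<in> Mor A Y S" and "Comp A Y S Y ?row s = Idm A Y"
      by (auto simp: retraction_mor_def)
    then have "Comp A Y Z Y h (Comp A Y S Z p s) \<oplus>\<^bsub>Hom A Y Y\<^esub> Comp A Y W Y b (Comp A Y S W q s)
        = Idm A Y"
      by (simp add: Comp_add_left Comp_assoc)
    moreover have "Comp A Y W Y b (Comp A Y S W q s) \<in> rad A Y Y"
      using b by (intro rad_Comp_right) simp_all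
    ultimately show ?thesis using retraction_if_modulo_rad[of Z Y h "Comp A Y S Z p s"] by simp
  next
    assume "section_mor A X S ?col"
    then obtain s where s[simp]: "s \<in> Mor A S X" and "Comp A X S X s ?col = Idm A X"
      by (auto simp: section_mor_def)
    then have "Comp A X Z X (Comp A Z S X s i) g \<oplus>\<^bsub>Hom A X X\<^esub> Comp A X W X (Comp A W S X s j) a
        = Idm A X"
      by (simp add: Comp_add_right Comp_assoc)
    moreover have "Comp A X W X (Comp A W S X s j) a \<in> rad A X X"
      using a by (intro rad_Comp_left) simp_all
    ultimately show ?thesis using section_if_modulo_rad[of X Z g "Comp A Z S X s i"] by simp
  qed
qed

end


section \<open>Morphisms of the quotient category\<close>

locale k_linear_category_ideal = k_linear_category +
  fixes I :: "'c \<Rightarrow> 'c \<Rightarrow> 'd set"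
  assumes ideal: "ideal_of k A I"
begin

abbreviation coset :: "'c \<Rightarrow> 'c \<Rightarrow> 'd \<Rightarrow> 'd set"
  where "coset X Y f \<equiv> I X Y +>\<^bsub>Hom A X Y\<^esub> f"

lemma ideal_submodule:
  "\<lbrakk>X \<in> Ob A; Y \<in> Ob A\<rbrakk> \<Longrightarrow> submodule (I X Y) k (Hom A X Y)"
  using ideal by (simp add: ideal_of_def)

lemma ideal_in_Mor: "\<lbrakk>X \<in> Ob A; Y \<in> Ob A; c \<in> I X Y\<rbrakk> \<Longrightarrow> c \<in> Mor A X Y"
  using module.submoduleE(1)[OF Hom_module ideal_submodule] by blast

lemma zero_in_ideal: "\<lbrakk>X \<in> Ob A; Y \<in> Ob A\<rbrakk> \<Longrightarrow> \<zero>\<^bsub>Hom A X Y\<^esub> \<in> I X Y"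
  using subgroup.one_closed[OF submodule.axioms(1)[OF ideal_submodule]] by simp

lemma ideal_abelian_subgroup:
  assumes "X \<in> Ob A" "Y \<in> Ob A"
  shows "abelian_subgroup (I X Y) (Hom A X Y)"
proof -
  interpret abelian_group "Hom A X Y" using assms by (rule Hom_abelian_group)
  have "additive_subgroup (I X Y) (Hom A X Y)"
    using submodule.axioms(1)[OF ideal_submodule[OF assms]] by (simp add: additive_subgroup_def)
  then show ?thesis using abelian_subgroupI3 abelian_group_axioms by blast
qed

lemma coset_eq_iff:
  assumes ob: "X \<in> Ob A" "Y \<in> Ob A" and f: "f \<in> Mor A X Y" and g: "g \<in> Mor A X Y"
  shows "coset X Y f = coset X Y g \<longleftrightarrow> (\<exists>c\<in>I X Y. f = g \<oplus>\<^bsub>Hom A X Y\<^esub> c)"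
proof -
  interpret abelian_subgroup "I X Y" "Hom A X Y" using ob by (rule ideal_abelian_subgroup)
  have "coset X Y f = coset X Y g \<longleftrightarrow> f \<in> coset X Y g"
    using f g a_repr_independence[OF _ g a_subgroup] a_rcos_self by metis
  also have "\<dots> \<longleftrightarrow> (\<exists>c\<in>I X Y. f = c \<oplus>\<^bsub>Hom A X Y\<^esub> g)"
    by (auto simp: a_r_coset_def')
  also have "\<dots> \<longleftrightarrow> (\<exists>c\<in>I X Y. f = g \<oplus>\<^bsub>Hom A X Y\<^esub> c)"
    using g ideal_in_Mor[OF ob] by (metis a_comm)
  finally show ?thesis .
qed

lemma Ob_quotient: "Ob (quotient_category A I) = Ob A"
  by (simp add: quotient_category_def)

lemma Idm_quotient: "Idm (quotient_category A I) X = coset X X (Idm A X)"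
  by (simp add: quotient_category_def)

lemma Mor_quotient: "Mor (quotient_category A I) X Y = coset X Y ` Mor A X Y"
  by (auto simp: quotient_category_def quotient_module_def A_RCOSETS_def')

lemma Comp_quotient:
  assumes ob: "X \<in> Ob A" "Y \<in> Ob A" "Z \<in> Ob A" and f: "f \<in> Mor A X Y" and g: "g \<in> Mor A Y Z"
  shows "Comp (quotient_category A I) X Y Z (coset Y Z g) (coset X Y f)
    = coset X Z (Comp A X Y Z g f)"
proof -
  interpret XY: abelian_subgroup "I X Y" "Hom A X Y" using ob by (simp add: ideal_abelian_subgroup)
  interpret YZ: abelian_subgroup "I Y Z" "Hom A Y Z" using ob by (simp add: ideal_abelian_subgroup)
  interpret XZ: abelian_subgroup "I X Z" "Hom A X Z" using ob by (simp add: ideal_abelian_subgroup)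
  have *: "coset X Z (Comp A X Y Z g' f') = coset X Z (Comp A X Y Z g f)"
    if f': "f' \<in> coset X Y f" and g': "g' \<in> coset Y Z g" for f' g'
  proof -
    obtain c where c: "c \<in> I X Y" "f' = c \<oplus>\<^bsub>Hom A X Y\<^esub> f" using f' by (auto simp: a_r_coset_def')
    obtain d where d: "d \<in> I Y Z" "g' = d \<oplus>\<^bsub>Hom A Y Z\<^esub> g" using g' by (auto simp: a_r_coset_def')
    have cM[simp]: "c \<in> Mor A X Y" and dM[simp]: "d \<in> Mor A Y Z"
      using c d ideal_in_Mor ob by blast+
    have "Comp A X Y Z d f' \<in> I X Z"
      using ideal ob d c f unfolding ideal_of_def by auto
    moreover have "Comp A X Y Z g c \<in> I X Z"
      using ideal ob c g unfolding ideal_of_def by auto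
    ultimately have e: "Comp A X Y Z g c \<oplus>\<^bsub>Hom A X Z\<^esub> Comp A X Y Z d f' \<in> I X Z"
      by simp
    have f'M[simp]: "f' \<in> Mor A X Y" and g'M: "g' \<in> Mor A Y Z" using c d f g by auto
    have "Comp A X Y Z g' f' = Comp A X Y Z d f' \<oplus>\<^bsub>Hom A X Z\<^esub> Comp A X Y Z g f'"
      using ob f g d by (simp add: Comp_add_left)
    also have "Comp A X Y Z g f' = Comp A X Y Z g c \<oplus>\<^bsub>Hom A X Z\<^esub> Comp A X Y Z g f"
      using ob f g c(2) by (simp add: Comp_add_right)
    finally have "Comp A X Y Z g' f' = Comp A X Y Z g f \<oplus>\<^bsub>Hom A X Z\<^esub>
        (Comp A X Y Z g c \<oplus>\<^bsub>Hom A X Z\<^esub> Comp A X Y Z d f')"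
      using ob f g by (simp add: Comp_closed XZ.a_ac)
    then show ?thesis
      using e coset_eq_iff[of X Z] ob f g f'M g'M Comp_closed by blast
  qed
  have "f \<in> coset X Y f" "g \<in> coset Y Z g" using f g XY.a_rcos_self YZ.a_rcos_self by auto
  then have "(\<Union>g'\<in>coset Y Z g. \<Union>f'\<in>coset X Y f. coset X Z (Comp A X Y Z g' f'))
      = coset X Z (Comp A X Y Z g f)"
    using * by blast
  then show ?thesis by (simp add: quotient_category_def)
qed

lemma section_quotient_iff:
  assumes ob: "X \<in> Ob A" "Y \<in> Ob A" and f: "f \<in> Mor A X Y"
  shows "section_mor (quotient_category A I) X Y (coset X Y f) \<longleftrightarrow>
    (\<exists>s\<in>Mor A Y X. \<exists>c\<in>I X X. Idm A X = Comp A X Y X s f \<oplus>\<^bsub>Hom A X X\<^esub> c)"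
proof -
  have "section_mor (quotient_category A I) X Y (coset X Y f) \<longleftrightarrow>
      (\<exists>s\<in>Mor A Y X. coset X X (Idm A X) = coset X X (Comp A X Y X s f))"
    using ob f by (auto simp: section_mor_def Mor_quotient Idm_quotient Comp_quotient)
  then show ?thesis
    using ob f by (simp add: coset_eq_iff Idm_closed Comp_closed)
qed

lemma retraction_quotient_iff:
  assumes ob: "X \<in> Ob A" "Y \<in> Ob A" and f: "f \<in> Mor A X Y"
  shows "retraction_mor (quotient_category A I) X Y (coset X Y f) \<longleftrightarrow>
    (\<exists>s\<in>Mor A Y X. \<exists>c\<in>I Y Y. Idm A Y = Comp A Y X Y f s \<oplus>\<^bsub>Hom A Y Y\<^esub> c)"
proof -
  have "retraction_mor (quotient_category A I) X Y (coset X Y f) \<longleftrightarrow>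
      (\<exists>s\<in>Mor A Y X. coset Y Y (Idm A Y) = coset Y Y (Comp A Y X Y f s))"
    using ob f by (auto simp: retraction_mor_def Mor_quotient Idm_quotient Comp_quotient)
  then show ?thesis
    using ob f by (simp add: coset_eq_iff Idm_closed Comp_closed)
qed

text \<open>
  The quotient functor preserves one-sided inverses, and it reflects them at an object whose
  endomorphisms in the ideal are radical.
\<close>

lemma section_quotient_iff_section:
  assumes ob: "X \<in> Ob A" "Y \<in> Ob A" and f: "f \<in> Mor A X Y" and rad: "I X X \<subseteq> rad A X X"
  shows "section_mor (quotient_category A I) X Y (coset X Y f) \<longleftrightarrow> section_mor A X Y f"
proof
  assume "section_mor (quotient_category A I) X Y (coset X Y f)"
  then show "section_mor A X Y f"
    using section_if_modulo_rad[OF ob f] rad unfolding section_quotient_iff[OF ob f]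
    by (metis subsetD)
next
  assume "section_mor A X Y f"
  then obtain s where s: "s \<in> Mor A Y X" "Comp A X Y X s f = Idm A X"
    by (auto simp: section_mor_def)
  interpret XX: abelian_group "Hom A X X" using ob by (simp add: Hom_abelian_group)
  have "Idm A X = Comp A X Y X s f \<oplus>\<^bsub>Hom A X X\<^esub> \<zero>\<^bsub>Hom A X X\<^esub>"
    using s ob by (simp add: Idm_closed)
  then show "section_mor (quotient_category A I) X Y (coset X Y f)"
    using s(1) zero_in_ideal[OF ob(1) ob(1)] unfolding section_quotient_iff[OF ob f] by blast
qed

lemma retraction_quotient_iff_retraction:
  assumes ob: "X \<in> Ob A" "Y \<in> Ob A" and f: "f \<in> Mor A X Y" and rad: "I Y Y \<subseteq> rad A Y Y"
  shows "retraction_mor (quotient_category A I) X Y (coset X Y f) \<longleftrightarrow> retraction_mor A X Y f"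
proof
  assume "retraction_mor (quotient_category A I) X Y (coset X Y f)"
  then show "retraction_mor A X Y f"
    using retraction_if_modulo_rad[OF ob f] rad unfolding retraction_quotient_iff[OF ob f]
    by (metis subsetD)
next
  assume "retraction_mor A X Y f"
  then obtain s where s: "s \<in> Mor A Y X" "Comp A Y X Y f s = Idm A Y"
    by (auto simp: retraction_mor_def)
  interpret YY: abelian_group "Hom A Y Y" using ob by (simp add: Hom_abelian_group)
  have "Idm A Y = Comp A Y X Y f s \<oplus>\<^bsub>Hom A Y Y\<^esub> \<zero>\<^bsub>Hom A Y Y\<^esub>"
    using s ob by (simp add: Idm_closed)
  then show "retraction_mor (quotient_category A I) X Y (coset X Y f)"
    using s(1) zero_in_ideal[OF ob(2) ob(2)] unfolding retraction_quotient_iff[OF ob f] by blast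
qed

text \<open>
  Sections out of \<open>X\<close> and retractions onto \<open>Y\<close> are the same in both categories, so irreducibility
  in the quotient differs from irreducibility only in allowing factorisations up to the ideal.
\<close>

lemma irreducible_quotient_iff:
  assumes ob: "X \<in> Ob A" "Y \<in> Ob A" and f: "f \<in> Mor A X Y"
    and rad: "I X X \<subseteq> rad A X X" "I Y Y \<subseteq> rad A Y Y"
  shows "irreducible_mor (quotient_category A I) X Y (coset X Y f) \<longleftrightarrow>
    \<not> section_mor A X Y f \<and> \<not> retraction_mor A X Y f \<and>
    (\<forall>Z\<in>Ob A. \<forall>g\<in>Mor A X Z. \<forall>h\<in>Mor A Z Y. \<forall>c\<in>I X Y.
       f = Comp A X Z Y h g \<oplus>\<^bsub>Hom A X Y\<^esub> c \<longrightarrow> retraction_mor A Z Y h \<or> section_mor A X Z g)"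
proof -
  let ?Q = "quotient_category A I"
  have "(\<forall>Z\<in>Ob ?Q. \<forall>G\<in>Mor ?Q X Z. \<forall>H\<in>Mor ?Q Z Y. coset X Y f = Comp ?Q X Z Y H G \<longrightarrow>
        retraction_mor ?Q Z Y H \<or> section_mor ?Q X Z G) \<longleftrightarrow>
      (\<forall>Z\<in>Ob A. \<forall>g\<in>Mor A X Z. \<forall>h\<in>Mor A Z Y. coset X Y f = coset X Y (Comp A X Z Y h g) \<longrightarrow>
        retraction_mor A Z Y h \<or> section_mor A X Z g)"
    using ob rad by (simp add: Ob_quotient Mor_quotient Comp_quotient
        section_quotient_iff_section retraction_quotient_iff_retraction)
  also have "\<dots> \<longleftrightarrow> (\<forall>Z\<in>Ob A. \<forall>g\<in>Mor A X Z. \<forall>h\<in>Mor A Z Y. \<forall>c\<in>I X Y.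
       f = Comp A X Z Y h g \<oplus>\<^bsub>Hom A X Y\<^esub> c \<longrightarrow> retraction_mor A Z Y h \<or> section_mor A X Z g)"
    using ob f by (auto simp: coset_eq_iff Comp_closed)
  finally show ?thesis
    unfolding irreducible_mor_def using ob f rad
    by (auto simp: Mor_quotient section_quotient_iff_section retraction_quotient_iff_retraction)
qed

end

section \<open>Irreducibility modulo an admissible ideal\<close>

theorem proposition4p13:
  fixes k :: "('k, 'r) ring_scheme"
    and A :: "('k, 'o, 'm) k_cat"
    and I :: "'o \<Rightarrow> 'o \<Rightarrow> 'm set"
    and X Y :: 'o
    and Xs Ys :: "'o list"
    and f :: 'm
  assumes "cring k"
    and "krull_schmidt k A"
    and "admissible_ideal k A I"
    and "direct_sum A X Xs"
    and "\<forall>U\<in>set Xs. indecomposable A U \<and> Idm A U \<notin> I U U"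
    and "direct_sum A Y Ys"
    and "\<forall>V\<in>set Ys. indecomposable A V \<and> Idm A V \<notin> I V V"
    and "f \<in> Mor A X Y"
  shows "irreducible_mor A X Y f \<longleftrightarrow>
         irreducible_mor (quotient_category A I) X Y (I X Y +>\<^bsub>Hom A X Y\<^esub> f)"
proof -
  interpret krull_schmidt k A by fact
  interpret k_linear_category_ideal k A I
    by unfold_locales (use assms(3) in \<open>simp add: admissible_ideal_def\<close>)
  have ob: "X \<in> Ob A" "Y \<in> Ob A" using assms(4,6) by (auto simp: direct_sum_def)
  have XX: "I X X \<subseteq> rad A X X"
    using ideal_subset_rad_square[OF assms(3,4,5,4,5)] rad_square_subset_rad[OF ob(1) ob(1)]
    by blast
  have YY: "I Y Y \<subseteq> rad A Y Y"
    using ideal_subset_rad_square[OF assms(3,6,7,6,7)] rad_square_subset_rad[OF ob(2) ob(2)]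
    by blast
  have XY: "I X Y \<subseteq> rad_square k A X Y"
    using ideal_subset_rad_square[OF assms(3-7)] .
  interpret XY: abelian_group "Hom A X Y" using ob by (rule Hom_abelian_group)
  note quotient_iff = irreducible_quotient_iff[OF ob assms(8) XX YY]
  show ?thesis
  proof
    assume irr: "irreducible_mor A X Y f"
    then have "\<not> section_mor A X Y f" "\<not> retraction_mor A X Y f"
      by (auto simp: irreducible_mor_def)
    moreover have "retraction_mor A Z Y h \<or> section_mor A X Z g"
      if "Z \<in> Ob A" "g \<in> Mor A X Z" "h \<in> Mor A Z Y" "c \<in> I X Y"
        "f = Comp A X Z Y h g \<oplus>\<^bsub>Hom A X Y\<^esub> c" for Z g h c
      using irreducible_factor_modulo_rad_square[OF irr ob that(1-3) _ that(5)] that(4) XY by blast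
    ultimately show "irreducible_mor (quotient_category A I) X Y (I X Y +>\<^bsub>Hom A X Y\<^esub> f)"
      unfolding quotient_iff by blast
  next
    assume "irreducible_mor (quotient_category A I) X Y (I X Y +>\<^bsub>Hom A X Y\<^esub> f)"
    note irr = this[unfolded quotient_iff]
    have "retraction_mor A Z Y h \<or> section_mor A X Z g"
      if "Z \<in> Ob A" "g \<in> Mor A X Z" "h \<in> Mor A Z Y" "f = Comp A X Z Y h g" for Z g h
    proof -
      have "f = Comp A X Z Y h g \<oplus>\<^bsub>Hom A X Y\<^esub> \<zero>\<^bsub>Hom A X Y\<^esub>"
        using that(4) assms(8) by simp
      then show ?thesis using irr that(1-3) zero_in_ideal[OF ob] by blast
    qed
    then show "irreducible_mor A X Y f"
      unfolding irreducible_mor_def using irr assms(8) by blast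
  qed
qed

end
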